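(* Let $B\in\{1,2,3,4,6,7,8,9\}$ (i.e. $B\in\{1,\dots,9\}$, $B\neq 5$). Let $p\neq q$ be coprime positive integers satisfying $$B\,q^{3}-\frac{q^{3}}{3600^{3}}\leqslant p\leqslant B\,q^{3}+\frac{q^{3}}{3600^{3}}.$$ Then the tenth degree cuboid characteristic equation $Q_{pq}(t)=0$ produces no perfect cuboids, i.e. there is no positive integer $t$ such that the triple $(p,q,t)$ produces a perfect cuboid.
   Context: For integers $p,q$ the polynomial $Q_{pq}(t)\in\mathbb Z[t]$ is $$Q_{pq}(t)=t^{10}+(2q^{2}+p^{2})(3q^{2}-2p^{2})\,t^{8}+(q^{8}+10p^{2}q^{6}+4p^{4}q^{4}-14p^{6}q^{2}+p^{8})\,t^{6}-p^{2}q^{2}(q^{8}-14p^{2}q^{6}+4p^{4}q^{4}+10p^{6}q^{2}+p^{8})\,t^{4}-p^{6}q^{6}(q^{2}+2p^{2})(3p^{2}-2q^{2})\,t^{2}-q^{10}p^{10}.$$ A triple of positive integers $(p,q,t)$ with $p\neq q$ coprime is said to produce a perfect cuboid (a rectangular box with integer edges, integer face diagonals and integer space diagonal) exactly when $Q_{pq}(t)=0$ and $t>p^{2}$, $t>pq$, $t>q^{2}$, $(p^{2}+t)(pq+t)>2t^{2}$. *)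

theory Defs
  imports Complex_Main "HOL-Computational_Algebra.Polynomial"
begin

definition cuboid_poly :: "int \<Rightarrow> int \<Rightarrow> int poly" where
  "cuboid_poly p q =
     monom 1 10
     + monom ((2*q^2 + p^2) * (3*q^2 - 2*p^2)) 8
     + monom (q^8 + 10*p^2*q^6 + 4*p^4*q^4 - 14*p^6*q^2 + p^8) 6
     - monom (p^2*q^2 * (q^8 - 14*p^2*q^6 + 4*p^4*q^4 + 10*p^6*q^2 + p^8)) 4
     - monom (p^6*q^6 * (q^2 + 2*p^2) * (3*p^2 - 2*q^2)) 2
     - monom (q^10*p^10) 0"

definition produces_perfect_cuboid :: "int \<Rightarrow> int \<Rightarrow> int \<Rightarrow> bool" where
  "produces_perfect_cuboid p q t \<longleftrightarrow>
     p > 0 \<and> q > 0 \<and> t > 0 \<and> p \<noteq> q \<and> coprime p q \<and>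
     poly (cuboid_poly p q) t = 0 \<and>
     t > p^2 \<and> t > p*q \<and> t > q^2 \<and> (p^2 + t) * (p*q + t) > 2 * t^2"

end

theory Submission
  imports Defs
begin

text \<open>For \<open>p\<close> much larger than \<open>q\<close> the cuboid inequalities leave only the root
  \<open>t = p\<^sup>2 + 2 p q - 2 q\<^sup>2 + 5 q\<^sup>3/p - 20 q\<^sup>4/p\<^sup>2 + O(q\<^sup>5/p\<^sup>3)\<close>. With \<open>p\<close> close to
  \<open>B q\<^sup>3\<close>, the integer \<open>n = t - p\<^sup>2 - 2 p q + 2 q\<^sup>2\<close> is close to \<open>5/B\<close>, so \<open>B\<close> divides \<open>5\<close>,
  which leaves \<open>B = 1\<close> and \<open>n = 5\<close>. The next term of the expansion then forces
  \<open>p = q\<^sup>3 - 4 q\<close>, contradicting coprimality. If \<open>q < 3600\<close>, the interval for \<open>p\<close>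
  contains no integer but \<open>B q\<^sup>3\<close>, so coprimality gives \<open>q = 1\<close> and finitely many
  cases remain.\<close>

section \<open>The characteristic polynomial and an upper bound for the root\<close>

text \<open>Every summand carries \<open>q^2\<close> or \<open>(t^2 - p^4)^2\<close>, so
  substituting \<open>q = u*p\<close> and \<open>t^2 = (1 + u*v) * p^4\<close> makes the factor
  \<open>p^20 * u^2\<close> cancel.\<close>

lemma poly_cuboid_poly_factored:
  "poly (cuboid_poly p q) t =
     (t^2)^3 * (t^2 - p^4)^2
     - p^2*q^2 * (t^2)^2 * ((t^2)^2 + 14*p^4*t^2 + p^8)
     + 2*q^4 * (t^2)^2 * (t^2 - p^4) * (3*t^2 + 5*p^4)
     + 2*p^2*q^6 * t^2 * (t^2 - p^4) * (5*t^2 + 3*p^4)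
     + q^8 * t^2 * ((t^2)^2 + 14*p^4*t^2 + p^8)
     - p^2*q^10 * (t^2 - p^4)^2"
  by (simp add: cuboid_poly_def poly_monom) algebra

text \<open>For \<open>t = p^2 + s\<close> the last cuboid inequality becomes
  \<open>p^2 * (2*p*q - s) + s * (p*q - s) > 0\<close>, which fails once
  \<open>s \<ge> 2*p*q\<close>.\<close>

lemma cuboid_root_less:
  assumes "produces_perfect_cuboid p q t"
  shows "t < p^2 + 2*p*q"
proof (rule ccontr)
  assume "\<not> t < p^2 + 2*p*q"
  define s where "s = t - p^2"
  have pos: "p > 0" "q > 0" and ineq: "(p^2 + t) * (p*q + t) > 2 * t^2"
    using assms by (auto simp: produces_perfect_cuboid_def)
  have s: "s \<ge> 2*p*q" and t: "t = p^2 + s"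
    using \<open>\<not> t < p^2 + 2*p*q\<close> by (auto simp: s_def)
  have "p * q > 0" using pos by simp
  then have "s \<ge> 0" "p*q - s \<le> 0" using s by linarith+
  have "(p^2 + t) * (p*q + t) - 2 * t^2 = p^2 * (2*p*q - s) + s * (p*q - s)"
    unfolding t by algebra
  moreover have "p^2 * (2*p*q - s) \<le> 0"
    using s by (simp add: mult_nonneg_nonpos)
  moreover have "s * (p*q - s) \<le> 0"
    using \<open>s \<ge> 0\<close> \<open>p*q - s \<le> 0\<close> by (rule mult_nonneg_nonpos)
  ultimately show False using ineq by linarith
qed

section \<open>Asymptotic expansion of the root\<close>

lemma abs_diff_le_of_squares:
  fixes a b c d :: real
  assumes "\<bar>a^2 - b^2\<bar> \<le> d" "0 < c" "c \<le> a + b"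
  shows "\<bar>a - b\<bar> \<le> d / c"
proof -
  have "\<bar>a - b\<bar> * c \<le> \<bar>a - b\<bar> * (a + b)"
    using assms by (intro mult_left_mono) auto
  also have "\<dots> = \<bar>a^2 - b^2\<bar>"
    using assms by (simp add: power2_eq_square square_diff_square_factored abs_mult)
  finally show ?thesis using assms by (simp add: pos_le_divide_eq)
qed

lemma abs_le_of_mult_one_plus:
  fixes a b c :: real
  assumes "\<bar>a * (1 + b)\<bar> \<le> c" "0 \<le> b"
  shows "\<bar>a\<bar> \<le> c"
proof -
  have "\<bar>a\<bar> * 1 \<le> \<bar>a\<bar> * (1 + b)"
    using assms by (intro mult_left_mono) auto
  then show ?thesis using assms by (simp add: abs_mult)
qed

text \<open>The equation is the characteristic equation for \<open>u = q/p\<close> and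
  \<open>t\<^sup>2/p\<^sup>4 = 1 + u v\<close>, divided by \<open>u\<^sup>2\<close>. Apart from terms of order
  \<open>u\<^sup>5\<close> it reads \<open>(1 + u v) (v\<^sup>2 - 16) = u\<^sup>2 v\<^sup>2 - 16 u\<^sup>3 v - 6 u\<^sup>4 v\<^sup>2\<close>, and solving
  it for \<open>v\<close> by successive approximation takes two steps.\<close>

lemma reduced_root_asymptotics:
  fixes u v X :: real
  assumes u: "0 < u" "u \<le> 1/1000" and v: "0 < v" "v \<le> 5" and X: "X = 1 + u*v"
    and eq: "X^3 * v^2 - X^2 * (X^2 + 14*X + 1) + 2*u^3 * v * X^2 * (3*X + 5)
      + 2*u^5 * v * X * (5*X + 3) + u^6 * X * (X^2 + 14*X + 1) - u^10 * v^2 = 0"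
  shows "\<bar>v - (4 + 2*u^2 - 16*u^3)\<bar> \<le> 130 * u^4"
proof -
  \<comment> \<open>\<open>u^4 * E\<close> is the sum of the last three terms on the left of
    \<open>eq\<close>, divided by \<open>X^2\<close>.\<close>
  define E where "E = (2*u * v * X * (5*X + 3) + u^2 * X * (X^2 + 14*X + 1) - u^6 * v^2) / X^2"
  have uv: "0 < u*v" "u*v \<le> 1/200"
    using u v mult_mono[of u "1/1000" v 5] by auto
  have X1: "1 \<le> X" "X \<le> 201/200" using uv X by auto
  \<comment> \<open>Follows from \<open>X^2 + 14*X + 1 = 16*X + (u*v)^2\<close>.\<close>
  have step: "(v^2 - 16) * (1 + u*v) = u^2*v^2 - 16*u^3*v - 6*u^4*v^2 - u^4*E"
  proof -
    have "X^2 * (X * v^2 - (X^2 + 14*X + 1) + 2*u^3*v*(3*X + 5) + u^4*E) = 0"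
      unfolding E_def using X1 eq by (simp add: field_simps) algebra
    then have "X * v^2 - (X^2 + 14*X + 1) + 2*u^3*v*(3*X + 5) + u^4*E = 0"
      using X1 by simp
    then show ?thesis unfolding X by algebra
  qed
  have uvv: "0 \<le> (u*v)^2" "(u*v)^2 \<le> 1/100"
    using uv power_mono[of "u*v" "1/200" 2] by (auto simp: power_divide)
  have u2: "0 \<le> u^2" "u^2 \<le> 1/1000000"
    using u power_mono[of u "1/1000" 2] by (auto simp: power_divide)
  have E: "\<bar>E\<bar> \<le> 1"
  proof -
    have XX: "X*X \<le> 102/100" using X1 mult_mono[of X "201/200" X "201/200"] by auto
    then have "X*X*X \<le> 104/100" using X1 mult_mono[of "X*X" "102/100" X "201/200"] by auto
    then have c: "0 \<le> X * (5*X + 3)" "X * (5*X + 3) \<le> 10"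
        "0 \<le> X * (X^2 + 14*X + 1)" "X * (X^2 + 14*X + 1) \<le> 20"
      using X1 XX by (auto simp: power2_eq_square algebra_simps)
    have "(u*v) * (X * (5*X + 3)) \<le> 1/200 * 10"
      using uv c by (intro mult_mono) auto
    moreover have "0 \<le> (u*v) * (X * (5*X + 3))" using uv c by simp
    moreover have "u^2 * (X * (X^2 + 14*X + 1)) \<le> 1/1000000 * 20"
      using u2 c by (intro mult_mono) auto
    moreover have "0 \<le> u^2 * (X * (X^2 + 14*X + 1))" using c by simp
    moreover have "u^4 * (u*v)^2 \<le> 1 * (1/100)"
      using u uvv by (intro mult_mono power_le_one) auto
    moreover have "0 \<le> u^4 * (u*v)^2" by simp
    moreover have "X^2 * E = 2 * ((u*v) * (X * (5*X + 3))) + u^2 * (X * (X^2 + 14*X + 1)) - u^4 * (u*v)^2"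
      unfolding E_def using X1 by simp algebra
    ultimately have "\<bar>X^2 * E\<bar> \<le> 1" by linarith
    moreover have "1 * \<bar>E\<bar> \<le> X^2 * \<bar>E\<bar>" using X1 by (intro mult_right_mono) auto
    ultimately show ?thesis by (simp add: abs_mult)
  qed
  have uE: "\<bar>u^2 * E\<bar> \<le> 1/2"
    using mult_mono[of "u^2" "1/1000000" "\<bar>E\<bar>" 1] u2 E by (auto simp: abs_mult)
  have vv: "0 \<le> v^2" "v^2 \<le> 25" using v power_mono[of v 5 2] by auto
  \<comment> \<open>First approximation: the right-hand side of \<open>step\<close> is
    \<open>u^2\<close> times a bounded quantity, so \<open>v = 4 + O(u^2)\<close>.\<close>
  have "\<bar>(v^2 - 16) * (1 + u*v)\<bar> = \<bar>u^2 * (v^2 - 16*(u*v) - 6*(u*v)^2 - u^2*E)\<bar>"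
    unfolding step by (rule arg_cong[of _ _ abs]) algebra
  also have "\<dots> \<le> u^2 * 26"
  proof -
    have "\<bar>v^2 - 16*(u*v) - 6*(u*v)^2 - u^2*E\<bar> \<le> 26" using vv uv uvv uE by linarith
    then show ?thesis unfolding abs_mult abs_power2 by (intro mult_left_mono) auto
  qed
  finally have sq1: "\<bar>v^2 - 16\<bar> \<le> u^2 * 26"
    by (rule abs_le_of_mult_one_plus) (use uv in simp)
  then have v1: "\<bar>v - 4\<bar> \<le> u^2 * 26 / 4"
    using v by (intro abs_diff_le_of_squares) auto
  have u3: "0 \<le> u^3" "u^3 \<le> 1/1000000000"
    using u power_mono[of u "1/1000" 3] by (auto simp: power_divide)
  \<comment> \<open>Second approximation: in the terms of order \<open>u^2\<close> and
    \<open>u^3\<close>, \<open>v\<close> is replaced by 4. Half of \<open>128*u^3\<close> comes from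
    \<open>step\<close>, half from \<open>-16*u^2\<close> times \<open>1 + u*v\<close>. By the first
    approximation the error is \<open>O(u^4)\<close>.\<close>
  have "\<bar>(v^2 - 16 - 16*u^2 + 128*u^3) * (1 + u*v)\<bar>
      = \<bar>u^2 * (v^2 - 16) + 32*u^3 * (4 - v) + u^4 * (128*v - 6*v^2 - E)\<bar>"
    using step by (intro arg_cong[of _ _ abs]) algebra
  also have "\<dots> \<le> \<bar>u^2 * (v^2 - 16)\<bar> + \<bar>32*u^3 * (4 - v)\<bar> + \<bar>u^4 * (128*v - 6*v^2 - E)\<bar>"
    by linarith
  also have "\<dots> \<le> u^4 * 26 + u^4 * 1 + u^4 * 670"
  proof (intro add_mono)
    have "u^2 * \<bar>v^2 - 16\<bar> \<le> u^2 * (u^2 * 26)" using sq1 by (intro mult_left_mono) auto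
    then show "\<bar>u^2 * (v^2 - 16)\<bar> \<le> u^4 * 26" by (simp add: abs_mult power4_eq_xxxx power2_eq_square)
    have "32*u^3 * \<bar>4 - v\<bar> \<le> 32*u^3 * (u^2 * 26 / 4)"
      using v1 u by (intro mult_left_mono) (auto simp: abs_minus_commute)
    also have "\<dots> = u^4 * (208 * u)" by algebra
    also have "\<dots> \<le> u^4 * 1" using u by (intro mult_left_mono) auto
    finally show "\<bar>32*u^3 * (4 - v)\<bar> \<le> u^4 * 1" using u by (simp add: abs_mult)
    have "\<bar>128*v - 6*v^2 - E\<bar> \<le> 670" using v vv E by linarith
    then show "\<bar>u^4 * (128*v - 6*v^2 - E)\<bar> \<le> u^4 * 670"
      using u by (auto simp: abs_mult)
  qed
  finally have "\<bar>(v^2 - 16 - 16*u^2 + 128*u^3) * (1 + u*v)\<bar> \<le> u^4 * 697" by simp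
  then have sq2: "\<bar>v^2 - 16 - 16*u^2 + 128*u^3\<bar> \<le> u^4 * 697"
    by (rule abs_le_of_mult_one_plus) (use uv in simp)
  \<comment> \<open>The bounded term is the excess of \<open>(4 + 2*u^2 - 16*u^3)^2\<close> over
    \<open>16 + 16*u^2 - 128*u^3\<close>.\<close>
  have "\<bar>u^4 * (4 - 64*u + 256*u^2)\<bar> \<le> u^4 * 5"
    unfolding abs_mult using u u2 by (intro mult_mono) auto
  moreover have "v^2 - (4 + 2*u^2 - 16*u^3)^2
      = (v^2 - 16 - 16*u^2 + 128*u^3) - u^4 * (4 - 64*u + 256*u^2)"
    by algebra
  ultimately have "\<bar>v^2 - (4 + 2*u^2 - 16*u^3)^2\<bar> \<le> u^4 * 702"
    using sq2 by linarith
  moreover have "7 \<le> v + (4 + 2*u^2 - 16*u^3)" using v1 u2 u3 by linarith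
  ultimately have "\<bar>v - (4 + 2*u^2 - 16*u^3)\<bar> \<le> u^4 * 702 / 7"
    by (intro abs_diff_le_of_squares) auto
  also have "\<dots> \<le> 130 * u^4" using u by simp
  finally show ?thesis .
qed

text \<open>This is the expansion of \<open>t\<close>, multiplied by \<open>p^3\<close> to clear
  denominators. The bounds \<open>p^2 < t < p^2 + 2*p*q\<close> give \<open>0 < v \<le> 5\<close>
  and so single out the root.\<close>

lemma cuboid_root_asymptotics:
  fixes p q t :: int
  assumes cub: "produces_perfect_cuboid p q t" and small: "1000 * q \<le> p"
  shows "\<bar>real_of_int (t - (p^2 + 2*p*q - 2*q^2)) * real_of_int p ^ 2
            - 5 * real_of_int q ^ 3 * real_of_int p + 20 * real_of_int q ^ 4\<bar> * real_of_int p
          \<le> 120 * real_of_int q ^ 5"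
proof -
  define P Q T where "P = real_of_int p" and "Q = real_of_int q" and "T = real_of_int t"
  define u y where "u = Q / P" and "y = T / P^2"
  define v where "v = (y^2 - 1) / u"
  have pos: "P > 0" "Q > 0" and "p > 0" "q > 0"
    using cub by (auto simp: produces_perfect_cuboid_def P_def Q_def)
  have root: "poly (cuboid_poly p q) t = 0" and low: "t > p^2"
    using cub by (auto simp: produces_perfect_cuboid_def)
  have Qu: "Q = u * P" and Ty: "T = y * P^2"
    using pos by (auto simp: u_def y_def)
  have u: "0 < u" "u \<le> 1/1000"
    using pos small unfolding u_def P_def Q_def by (auto simp: field_simps)
  have "real_of_int (p^2) < T" unfolding T_def using low by (rule of_int_less_iff[THEN iffD2])
  then have y1: "1 < y" using pos by (simp add: y_def P_def field_simps)
  have "T < real_of_int (p^2 + 2*p*q)" unfolding T_def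
    using cuboid_root_less[OF cub] by (rule of_int_less_iff[THEN iffD2])
  then have "y * P^2 < (1 + 2*u) * P^2"
    unfolding Ty using Qu by (simp add: P_def Q_def algebra_simps power2_eq_square)
  then have y2: "y < 1 + 2*u" using pos by simp
  have Xv: "y^2 = 1 + u*v" using u by (simp add: v_def)
  have "u * 0 < u * v" using Xv y1 by (smt (verit) one_less_power zero_less_numeral mult_zero_right)
  then have v0: "0 < v" using u zero_less_mult_pos by fastforce
  have "y^2 \<le> (1 + 2*u)^2" using y1 y2 by (intro power_mono) auto
  then have "u * v \<le> u * (4 + 4*u)" using Xv by (simp add: power2_eq_square algebra_simps)
  then have v5: "v \<le> 5" using u by simp
  have "real_of_int (poly (cuboid_poly p q) t) = 0" using root by simp
  then have "(T^2)^3 * (T^2 - P^4)^2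
     - P^2*Q^2 * (T^2)^2 * ((T^2)^2 + 14*P^4*T^2 + P^8)
     + 2*Q^4 * (T^2)^2 * (T^2 - P^4) * (3*T^2 + 5*P^4)
     + 2*P^2*Q^6 * T^2 * (T^2 - P^4) * (5*T^2 + 3*P^4)
     + Q^8 * T^2 * ((T^2)^2 + 14*P^4*T^2 + P^8)
     - P^2*Q^10 * (T^2 - P^4)^2 = 0"
    unfolding poly_cuboid_poly_factored by (simp add: P_def Q_def T_def)
  moreover have "T^2 = (1 + u*v) * P^4" using Ty Xv by algebra
  moreover define X where "X = 1 + u*v"
  ultimately have "(P^20 * u^2) * (X^3 * v^2 - X^2 * (X^2 + 14*X + 1) + 2*u^3 * v * X^2 * (3*X + 5)
      + 2*u^5 * v * X * (5*X + 3) + u^6 * X * (X^2 + 14*X + 1) - u^10 * v^2) = 0"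
    using Qu by algebra
  then have "X^3 * v^2 - X^2 * (X^2 + 14*X + 1) + 2*u^3 * v * X^2 * (3*X + 5)
      + 2*u^5 * v * X * (5*X + 3) + u^6 * X * (X^2 + 14*X + 1) - u^10 * v^2 = 0"
    using pos u by simp
  from reduced_root_asymptotics[OF u v0 v5 X_def this]
  have v: "\<bar>v - (4 + 2*u^2 - 16*u^3)\<bar> \<le> 130 * u^4" .
  \<comment> \<open>\<open>y0\<close> is the Taylor polynomial of degree 4 of
    \<open>sqrt (1 + 4*u + 2*u^3 - 16*u^4)\<close>, which is \<open>y\<close> with \<open>v\<close>
    replaced by its approximation. Hence \<open>y^2\<close> and \<open>y0^2\<close> differ only in
    order \<open>u^5\<close>.\<close>
  define y0 where "y0 = 1 + 2*u - 2*u^2 + 5*u^3 - 20*u^4"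
  have u2: "0 \<le> u^2" "u^2 \<le> 1/1000 * u" using u by (auto simp: power2_eq_square)
  have u3: "0 \<le> u^3" "u^3 \<le> 1/1000 * u^2" using u mult_right_mono[of u "1/1000" "u^2"] by (auto simp: power_numeral_reduce)
  have u4: "0 \<le> u^4" "u^4 \<le> 1/1000 * u^3" using u mult_right_mono[of u "1/1000" "u^3"] by (auto simp: power_numeral_reduce)
  have y0: "1 \<le> y0" unfolding y0_def using u u2 u3 u4 by linarith
  have "y^2 - y0^2 = u * (v - (4 + 2*u^2 - 16*u^3)) + u^5 * (100 - 105*u + 200*u^2 - 400*u^3)"
    using Xv unfolding y0_def by algebra
  moreover have "u * \<bar>v - (4 + 2*u^2 - 16*u^3)\<bar> \<le> u * (130 * u^4)"
    using u v by (intro mult_left_mono) auto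
  then have "\<bar>u * (v - (4 + 2*u^2 - 16*u^3))\<bar> \<le> u^5 * 130"
    using u by (simp add: abs_mult power_numeral_reduce)
  moreover have "\<bar>100 - 105*u + 200*u^2 - 400*u^3\<bar> \<le> 101"
    using u u2 u3 by linarith
  then have "\<bar>u^5 * (100 - 105*u + 200*u^2 - 400*u^3)\<bar> \<le> u^5 * 101"
    unfolding abs_mult using u by (intro mult_mono) auto
  ultimately have "\<bar>y^2 - y0^2\<bar> \<le> u^5 * 231" by linarith
  then have "\<bar>y - y0\<bar> \<le> u^5 * 231 / 2"
    using y1 y0 by (intro abs_diff_le_of_squares) auto
  then have "\<bar>y - y0\<bar> * P^5 \<le> u^5 * 231 / 2 * P^5"
    using pos by (intro mult_right_mono) auto
  also have "\<dots> \<le> 120 * Q^5"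
    using pos u by (simp add: Qu power_mult_distrib)
  finally have "\<bar>(y - y0) * P^4\<bar> * P \<le> 120 * Q^5"
    using pos by (simp add: abs_mult power_numeral_reduce mult_ac)
  moreover have "(y - y0) * P^4 = (T - (P^2 + 2*P*Q - 2*Q^2)) * P^2 - 5*Q^3*P + 20*Q^4"
    unfolding Qu Ty y0_def by algebra
  ultimately show ?thesis
    by (simp add: P_def Q_def T_def)
qed

section \<open>Exclusion of \<open>p\<close> close to \<open>B*q^3\<close>\<close>

text \<open>Settles \<open>q = 1\<close>, where \<open>p = B\<close>, and
  \<open>p \<noteq> q\<close> excludes \<open>p = 1\<close>. The bounds on \<open>t\<close> confine
  \<open>s\<close> to 1, ..., 17, and the polynomial is evaluated at every pair.\<close>

lemma no_perfect_cuboid_small: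
  fixes p t :: int
  assumes "2 \<le> p" "p \<le> 9"
  shows "\<not> produces_perfect_cuboid p 1 t"
proof
  assume cub: "produces_perfect_cuboid p 1 t"
  then have t: "p^2 < t" "t < p^2 + 2*p" and root: "poly (cuboid_poly p 1) t = 0"
    using cuboid_root_less[OF cub] by (auto simp: produces_perfect_cuboid_def)
  define s where "s = t - p^2"
  have ts: "t = p^2 + s" by (simp add: s_def)
  have p: "p \<in> {2, 3, 4, 5, 6, 7, 8, 9}" using assms by auto
  have "1 \<le> s" "s \<le> 17" "s < 2*p" using t assms by (auto simp: s_def)
  then have s: "s \<in> {1,2,3,4,5,6,7,8,9,10,11,12,13,14,15,16,17}"
    unfolding insert_iff empty_iff by presburger
  show False
    using root s p unfolding poly_cuboid_poly_factored ts
    by (elim insertE emptyE; simp)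
qed

theorem theorem9p1:
  fixes B p q :: int
  assumes "B \<in> {1, 2, 3, 4, 6, 7, 8, 9}"
    and "p > 0" and "q > 0" and "p \<noteq> q" and "coprime p q"
    and "real_of_int B * real_of_int q ^ 3 - real_of_int q ^ 3 / 3600 ^ 3 \<le> real_of_int p"
    and "real_of_int p \<le> real_of_int B * real_of_int q ^ 3 + real_of_int q ^ 3 / 3600 ^ 3"
  shows "\<not> (\<exists>t::int. t > 0 \<and> produces_perfect_cuboid p q t)"
proof
  assume "\<exists>t::int. t > 0 \<and> produces_perfect_cuboid p q t"
  then obtain t where cub: "produces_perfect_cuboid p q t" by blast
  define P Q where "P = real_of_int p" and "Q = real_of_int q"
  define \<delta> where "\<delta> = P - B * Q^3"
  have B: "1 \<le> B" "B \<le> 9" using assms(1) by auto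
  have pos: "P > 0" "Q > 0" using assms by (auto simp: P_def Q_def)
  have \<delta>: "\<bar>\<delta>\<bar> \<le> Q^3 / 3600^3"
    using assms(6,7) unfolding \<delta>_def P_def Q_def by linarith
  have q1: "q = 1" if "q dvd p"
    using that assms by (metis coprime_absorb_right is_unit_normalize normalize_int_def abs_of_pos)
  show False
  proof (cases "q < 3600")
    case True
    then have "Q^3 < 3600^3"
      using pos unfolding Q_def by (intro power_strict_mono) auto
    then have "\<bar>\<delta>\<bar> < 1" using \<delta> by simp
    moreover have "\<delta> = real_of_int (p - B * q^3)" by (simp add: \<delta>_def P_def Q_def)
    ultimately have "p = B * q^3" by linarith
    then have "q dvd p" by simp
    then have "q = 1" by (rule q1)
    moreover from this have "p = B" using \<open>p = B * q^3\<close> by simp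
    ultimately show False
      using no_perfect_cuboid_small[of p t] cub B assms(4) by auto
  next
    case False
    then have Q: "Q \<ge> 3600" by (simp add: Q_def)
    have "Q^3 > 0" using pos by simp
    have "1 * Q^3 \<le> B * Q^3" using B pos by (intro mult_right_mono) auto
    moreover have \<delta>_small: "\<bar>\<delta>\<bar> \<le> 1/1000 * Q^3" using \<delta> \<open>Q^3 > 0\<close> by simp
    ultimately have PQ: "Q^3 \<le> 101/100 * P" and "9/10 * Q^3 \<le> P"
      using \<open>Q^3 > 0\<close> unfolding \<delta>_def by linarith+
    have "3600 * 3600 * Q \<le> Q * Q * Q" using Q by (intro mult_mono) auto
    then have P_big: "1000 * Q \<le> P"
      using \<open>9/10 * Q^3 \<le> P\<close> pos unfolding power3_eq_cube by linarith
    define n where "n = t - (p^2 + 2*p*q - 2*q^2)"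
    \<comment> \<open>Writing \<open>Q^3 = R * P\<close> with bounded \<open>R\<close> lets powers
      of \<open>P\<close> cancel from the estimates.\<close>
    define R where "R = Q^3 / P"
    have R: "0 < R" "R \<le> 101/100" and RP: "Q^3 = R * P"
      using pos PQ by (auto simp: R_def field_simps)
    have "1000 * q \<le> p" using P_big unfolding P_def Q_def by linarith
    from cuboid_root_asymptotics[OF cub this]
    have "\<bar>n * P^2 - 5*Q^3*P + 20*Q^4\<bar> * P \<le> 120 * Q^5"
      by (simp add: n_def P_def Q_def)
    also have "n * P^2 - 5*Q^3*P + 20*Q^4 = (n*P - 5*Q^3 + 20*Q*R) * P"
      using RP by algebra
    \<comment> \<open>The extra factor \<open>Q\<close> turns the bound into a multiple of
      \<open>Q^6 = R^2 * P^2\<close>, so the error is \<open>O(1/Q)\<close>.\<close>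
    finally have "(\<bar>n*P - 5*Q^3 + 20*Q*R\<bar> * Q) * P^2 \<le> 120 * Q^5 * Q"
      using pos by (simp add: abs_mult power2_eq_square mult_ac)
    also have "120 * Q^5 * Q = (120 * R^2) * P^2" using RP by algebra
    finally have "\<bar>n*P - 5*Q^3 + 20*Q*R\<bar> * Q \<le> 120 * R^2" using pos by simp
    moreover have "R^2 \<le> (101/100)^2" using R by (intro power_mono) auto
    moreover have "\<bar>n*P - 5*Q^3 + 20*Q*R\<bar> * 3600 \<le> \<bar>n*P - 5*Q^3 + 20*Q*R\<bar> * Q"
      using Q by (intro mult_left_mono) auto
    ultimately have main: "\<bar>n*P - 5*Q^3 + 20*Q*R\<bar> \<le> 1/25" by (simp add: power_divide)
    have QR: "0 < Q*R" "Q*R \<le> Q * (101/100)" using pos R by auto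
    have nP: "\<bar>n*P - 5*Q^3\<bar> \<le> 21*Q" using main QR Q by linarith
    \<comment> \<open>Since \<open>B*Q^3 = P - \<delta>\<close>, the error is at most
      \<open>189*Q + 5*\<bar>\<delta>\<bar>\<close>, less than \<open>P\<close>; the integer
      \<open>B*n - 5\<close> must vanish.\<close>
    have "\<bar>(B*n - 5) * P\<bar> = \<bar>B * (n*P - 5*Q^3) - 5*\<delta>\<bar>"
      by (simp add: \<delta>_def algebra_simps)
    also have "\<dots> \<le> B * \<bar>n*P - 5*Q^3\<bar> + 5*\<bar>\<delta>\<bar>"
      using B abs_triangle_ineq4[of "B * (n*P - 5*Q^3)" "5*\<delta>"] by (simp add: abs_mult)
    also have "\<dots> \<le> 9 * (21*Q) + 5*\<bar>\<delta>\<bar>"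
      using B nP by (intro add_mono mult_mono) auto
    also have "\<dots> < P" using \<delta>_small PQ P_big pos by linarith
    finally have "\<bar>real_of_int (B*n - 5)\<bar> < 1" using pos by (simp add: abs_mult)
    then have "B * n = 5" by linarith
    then have "B dvd 5" by (metis dvd_triv_left)
    then have "B = 1" using assms(1) by auto
    then have "n = 5" using \<open>B * n = 5\<close> by simp
    \<comment> \<open>Now \<open>n*P - 5*Q^3 = 5*\<delta>\<close>, so this is \<open>main\<close>
      divided by 5.\<close>
    have near: "\<bar>\<delta> + 4*Q*R\<bar> \<le> 1/125"
      using main unfolding \<delta>_def \<open>B = 1\<close> \<open>n = 5\<close> of_int_1 of_int_numeral by linarith
    then have "\<bar>\<delta>\<bar> \<le> 5*Q" using QR Q by linarith
    \<comment> \<open>Replacing \<open>R\<close> by 1 costs \<open>4*Q*\<delta>/P\<close>, which is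
      small because \<open>\<delta>\<close> is \<open>O(Q)\<close> while \<open>P\<close> has order
      \<open>Q^3\<close>.\<close>
    have "\<delta> + 4*Q = (\<delta> + 4*Q*R) + 4*Q*(1 - R)" by algebra
    moreover have "\<bar>4*Q*(1 - R)\<bar> \<le> 1/2"
    proof -
      have "(1 - R) * P = \<delta>" using RP by (simp add: \<delta>_def \<open>B = 1\<close> algebra_simps)
      then have "\<bar>4*Q*(1 - R)\<bar> * P = 4*Q*\<bar>\<delta>\<bar>"
        using pos by (metis (no_types, opaque_lifting) abs_mult abs_of_pos mult.assoc mult_pos_pos zero_less_numeral)
      also have "\<dots> \<le> 4*Q*(5*Q)" using \<open>\<bar>\<delta>\<bar> \<le> 5*Q\<close> pos by (intro mult_left_mono) auto
      also have "\<dots> \<le> 1/2 * P"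
      proof -
        have "3600 * (Q*Q) \<le> Q * (Q*Q)" using Q by (intro mult_right_mono) auto
        then show ?thesis
          using \<open>9/10 * Q^3 \<le> P\<close> mult_pos_pos[OF pos(2) pos(2)] by (simp add: power3_eq_cube mult.assoc)
      qed
      finally show ?thesis using pos by simp
    qed
    ultimately have "\<bar>\<delta> + 4*Q\<bar> < 1" using near by linarith
    moreover have "\<delta> + 4*Q = real_of_int (p - q^3 + 4*q)"
      by (simp add: \<delta>_def P_def Q_def \<open>B = 1\<close>)
    ultimately have "p = q^3 - 4*q" by linarith
    then have "p = q * (q^2 - 4)" by algebra
    then have "q = 1" using q1 by simp
    then show False using False by simp
  qed
qed

end
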